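(* Let $\mu \in \mathcal{P}$, let $u_{h,\mu} \in V_h^{\mathrm{pr}}$ and $p_{h,\mu} \in V_h^{\mathrm{du}}$ be solutions of the discrete primal and dual equations $$a_\mu(u_{h,\mu}, v_h) = l_\mu(v_h) \quad \text{for all } v_h \in V_h^{\mathrm{du}}, \qquad a_\mu(q_h, p_{h,\mu}) = j_\mu(q_h) + 2 k_\mu(q_h, u_{h,\mu}) \quad \text{for all } q_h \in V_h^{\mathrm{pr}},$$ and let $u_{r,\mu} \in V_r^{\mathrm{pr}}$ and $p_{r,\mu} \in V_r^{\mathrm{du}}$ be solutions of the Petrov-Galerkin reduced primal and dual equations $$a_\mu(u_{r,\mu}, v_r) = l_\mu(v_r) \quad \text{for all } v_r \in V_r^{\mathrm{du}}, \qquad a_\mu(q_r, p_{r,\mu}) = j_\mu(q_r) + 2 k_\mu(q_r, u_{r,\mu}) \quad \text{for all } q_r \in V_r^{\mathrm{pr}}.$$ Then the following hold: (i) $\|u_{h,\mu} - u_{r,\mu}\| \leq \Delta_{\mathrm{pr}}(\mu) := \alpha_\mu^{-1}\, \|r_\mu^{\mathrm{pr}}(u_{r,\mu})\|$; (ii) $\|p_{h,\mu} - p_{r,\mu}\| \leq \Delta_{\mathrm{du}}(\mu) := \alpha_\mu^{-1}\big(2\gamma_{k_\mu}\, \Delta_{\mathrm{pr}}(\mu) + \|r_\mu^{\mathrm{du}}(u_{r,\mu}, p_{r,\mu})\|\big)$; (iii) $|\hat{\mathcal{J}}_h(\mu) - \hat{\mathcal{J}}_r(\mu)| \leq \Delta_{\hat{\mathcal{J}}_r}(\mu)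 := \Delta_{\mathrm{pr}}(\mu)\, \|r_\mu^{\mathrm{du}}(u_{r,\mu}, p_{r,\mu})\| + \Delta_{\mathrm{pr}}(\mu)^2\, \gamma_{k_\mu}$. Here $\alpha_\mu$ is the inf-sup stability constant of $a_\mu$ and $\gamma_{k_\mu}$ is the continuity constant of $k_\mu$.
   Context: $V$ is a real Hilbert space with inner product $(\cdot,\cdot)$ and induced norm $\|\cdot\|$; $V'$ is its dual, and the norm $\|\cdot\|$ of an element of $V'$ is the dual norm. The admissible parameter set is the box $\mathcal{P} = \{\mu \in \mathbb{R}^P : \mu_{\mathsf a} \le \mu \le \mu_{\mathsf b}\}$ (componentwise), with $P \in \mathbb{N}$ and $\mu_{\mathsf a}, \mu_{\mathsf b} \in \mathbb{R}^P$. For each $\mu \in \mathcal{P}$: $a_\mu : V \times V \to \mathbb{R}$ is a continuous coercive bilinear form (not assumed symmetric), $l_\mu, j_\mu : V \to \mathbb{R}$ are continuous linear functionals, and $k_\mu : V \times V \to \mathbb{R}$ is a continuous symmetric bilinear form. The cost functional is $\mathcal{J}(u,\mu) = \Theta(\mu) + j_\mu(u) + k_\mu(u,u)$, with $\Theta : \mathcal{P} \to \mathbb{R}$. Discrete spaces: $V_h^{\mathrm{pr}}, V_h^{\mathrm{du}} \subset V$ are finite-dimensional subspaces with $\dim V_h^{\mathrm{pr}} = \dim V_h^{\mathrm{du}}$ (they need not coincide). Reduced spaces: $V_r^{\mathrm{pr}} \subset V_h^{\mathrm{pr}}$ and $V_r^{\mathrm{du}} \subset V_h^{\mathrm{du}}$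 are subspaces with $\dim V_r^{\mathrm{pr}} = \dim V_r^{\mathrm{du}}$. Residuals: for $u, p \in V$, the primal residual $r_\mu^{\mathrm{pr}}(u) \in V'$ and the dual residual $r_\mu^{\mathrm{du}}(u,p) \in V'$ are $$r_\mu^{\mathrm{pr}}(u)[v] := l_\mu(v) - a_\mu(u,v) \quad (v \in V), \qquad r_\mu^{\mathrm{du}}(u,p)[q] := j_\mu(q) + 2k_\mu(q,u) - a_\mu(q,p) \quad (q \in V).$$ Functionals: $\hat{\mathcal{J}}_h(\mu) := \mathcal{J}(u_{h,\mu},\mu)$ and $\hat{\mathcal{J}}_r(\mu) := \mathcal{J}(u_{r,\mu},\mu)$. Constants: $a_\mu$ is assumed inf-sup stable on $V_h^{\mathrm{pr}} \times V_h^{\mathrm{du}}$, with inf-sup constant $$\alpha_\mu := \inf_{0 \ne u \in V_h^{\mathrm{pr}}} \ \sup_{0 \ne v \in V_h^{\mathrm{du}}} \frac{a_\mu(u,v)}{\|u\|\,\|v\|} > 0,$$ and $\gamma_{k_\mu}$ is the continuity constant of $k_\mu$, so that $|k_\mu(u,v)| \le \gamma_{k_\mu}\|u\|\,\|v\|$ for all $u,v \in V$. *)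

theory Defs
  imports "HOL-Analysis.Analysis"
begin

definition finite_dim_subspace :: "'v::real_vector set \<Rightarrow> bool" where
  "finite_dim_subspace S \<longleftrightarrow> subspace S \<and> (\<exists>B. finite B \<and> span B = S)"

definition coercive :: "('v::real_normed_vector \<Rightarrow> 'v \<Rightarrow> real) \<Rightarrow> bool" where
  "coercive a \<longleftrightarrow> (\<exists>c>0. \<forall>v. c * (norm v)\<^sup>2 \<le> a v v)"

text \<open>The infimum and supremum are taken in the extended reals, so that they have their usual
  meaning also over the empty set. For a bounded form and nonzero spaces \<open>U\<close>, \<open>W\<close> the value is
  finite; for \<open>U = {0}\<close> it is \<open>\<infinity>\<close>.\<close>

definition infsup_const ::
  "('v::real_normed_vector \<Rightarrow> 'v \<Rightarrow> real) \<Rightarrow> 'v set \<Rightarrow> 'v set \<Rightarrow> ereal" where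
  "infsup_const a U W =
     (INF u \<in> U - {0}. SUP v \<in> W - {0}. ereal (a u v / (norm u * norm v)))"

text \<open>As in \<^const>\<open>onorm\<close>, pairs with \<open>u = 0\<close> or \<open>v = 0\<close> contribute \<open>0\<close> to the supremum.\<close>

definition continuity_const :: "('v::real_normed_vector \<Rightarrow> 'v \<Rightarrow> real) \<Rightarrow> real" where
  "continuity_const k = (SUP (u, v). \<bar>k u v\<bar> / (norm u * norm v))"

lemma continuity_const_bound:
  assumes "bounded_bilinear k"
  shows "\<bar>k u v\<bar> \<le> continuity_const k * norm u * norm v"
proof -
  interpret bounded_bilinear k by fact
  obtain K where K: "0 \<le> K" "\<And>x y. norm (k x y) \<le> norm x * norm y * K"
    using nonneg_bounded by blast
  have *: "\<bar>k x y\<bar> / (norm x * norm y) \<le> K" for x y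
  proof (cases "x = 0 \<or> y = 0")
    case True
    then show ?thesis using K(1) by (auto simp: zero_left zero_right)
  next
    case False
    then have "0 < norm x * norm y" by simp
    then show ?thesis using K(2)[of x y] by (simp add: pos_divide_le_eq mult.commute)
  qed
  have "bdd_above (range (\<lambda>(u, v). \<bar>k u v\<bar> / (norm u * norm v)))"
    by (rule bdd_aboveI[of _ K]) (use * in auto)
  from cSUP_upper[OF UNIV_I this, of "(u, v)"]
  have le: "\<bar>k u v\<bar> / (norm u * norm v) \<le> continuity_const k"
    unfolding continuity_const_def by simp
  show ?thesis
  proof (cases "u = 0 \<or> v = 0")
    case True
    then show ?thesis by (auto simp: zero_left zero_right)
  next
    case False
    then have "0 < norm u * norm v" by simp
    then show ?thesis using le by (simp add: pos_divide_le_eq mult.assoc)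
  qed
qed

text \<open>The residuals are elements of the dual space \<open>'v \<Rightarrow>\<^sub>L real\<close>, whose norm is the dual norm.
  \<^const>\<open>Blinfun\<close> is meaningful only on bounded linear maps; the two lemmas below
  confirm that this is the case here.\<close>

definition primal_residual ::
  "('v::real_normed_vector \<Rightarrow> 'v \<Rightarrow> real) \<Rightarrow> ('v \<Rightarrow> real) \<Rightarrow> 'v \<Rightarrow> 'v \<Rightarrow>\<^sub>L real" where
  "primal_residual a l u = Blinfun (\<lambda>v. l v - a u v)"

definition dual_residual ::
  "('v::real_normed_vector \<Rightarrow> 'v \<Rightarrow> real) \<Rightarrow> ('v \<Rightarrow> real) \<Rightarrow> ('v \<Rightarrow> 'v \<Rightarrow> real) \<Rightarrow>
    'v \<Rightarrow> 'v \<Rightarrow> 'v \<Rightarrow>\<^sub>L real" where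
  "dual_residual a j k u p = Blinfun (\<lambda>q. j q + 2 * k q u - a q p)"

lemma primal_residual_apply:
  assumes "bounded_bilinear a" "bounded_linear l"
  shows "blinfun_apply (primal_residual a l u) v = l v - a u v"
proof -
  have "bounded_linear (\<lambda>v. l v - a u v)"
    by (rule bounded_linear_sub[OF assms(2) bounded_bilinear.bounded_linear_right[OF assms(1)]])
  then show ?thesis
    unfolding primal_residual_def by (simp add: bounded_linear_Blinfun_apply)
qed

lemma dual_residual_apply:
  assumes "bounded_bilinear a" "bounded_linear j" "bounded_bilinear k"
  shows "blinfun_apply (dual_residual a j k u p) q = j q + 2 * k q u - a q p"
proof -
  have "bounded_linear (\<lambda>q. 2 * k q u)"
    by (rule bounded_linear_const_mult[OF bounded_bilinear.bounded_linear_left[OF assms(3)]])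
  then have "bounded_linear (\<lambda>q. j q + 2 * k q u - a q p)"
    by (rule bounded_linear_sub[OF bounded_linear_add[OF assms(2)]
          bounded_bilinear.bounded_linear_left[OF assms(1)]])
  then show ?thesis
    unfolding dual_residual_def by (simp add: bounded_linear_Blinfun_apply)
qed

definition cost ::
  "('m \<Rightarrow> real) \<Rightarrow> ('m \<Rightarrow> 'v \<Rightarrow> real) \<Rightarrow> ('m \<Rightarrow> 'v \<Rightarrow> 'v \<Rightarrow> real) \<Rightarrow> 'v \<Rightarrow> 'm \<Rightarrow> real" where
  "cost \<Theta> j k u \<mu> = \<Theta> \<mu> + j \<mu> u + k \<mu> u u"

definition reduced_cost ::
  "('m \<Rightarrow> real) \<Rightarrow> ('m \<Rightarrow> 'v \<Rightarrow> real) \<Rightarrow> ('m \<Rightarrow> 'v \<Rightarrow> 'v \<Rightarrow> real) \<Rightarrow> ('m \<Rightarrow> 'v) \<Rightarrow> 'm \<Rightarrow> real" where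
  "reduced_cost \<Theta> j k u \<mu> = cost \<Theta> j k (u \<mu>) \<mu>"

text \<open>In the estimators below, \<open>\<alpha>\<close> is the inf-sup constant, \<open>\<gamma>\<close> the continuity constant of \<open>k\<close>,
  and the inverse of \<open>\<alpha>\<close> is formed in the extended reals (so it is \<open>0\<close> for \<open>\<alpha> = \<infinity>\<close>).\<close>

definition \<Delta>_pr ::
  "ereal \<Rightarrow> ('v::real_normed_vector \<Rightarrow> 'v \<Rightarrow> real) \<Rightarrow> ('v \<Rightarrow> real) \<Rightarrow> 'v \<Rightarrow> real" where
  "\<Delta>_pr \<alpha> a l u = real_of_ereal (inverse \<alpha>) * norm (primal_residual a l u)"

definition \<Delta>_du ::
  "ereal \<Rightarrow> real \<Rightarrow> ('v::real_normed_vector \<Rightarrow> 'v \<Rightarrow> real) \<Rightarrow> ('v \<Rightarrow> real) \<Rightarrow> ('v \<Rightarrow> real) \<Rightarrow>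
    ('v \<Rightarrow> 'v \<Rightarrow> real) \<Rightarrow> 'v \<Rightarrow> 'v \<Rightarrow> real" where
  "\<Delta>_du \<alpha> \<gamma> a l j k u p =
     real_of_ereal (inverse \<alpha>) * (2 * \<gamma> * \<Delta>_pr \<alpha> a l u + norm (dual_residual a j k u p))"

definition \<Delta>_J ::
  "ereal \<Rightarrow> real \<Rightarrow> ('v::real_normed_vector \<Rightarrow> 'v \<Rightarrow> real) \<Rightarrow> ('v \<Rightarrow> real) \<Rightarrow> ('v \<Rightarrow> real) \<Rightarrow>
    ('v \<Rightarrow> 'v \<Rightarrow> real) \<Rightarrow> 'v \<Rightarrow> 'v \<Rightarrow> real" where
  "\<Delta>_J \<alpha> \<gamma> a l j k u p =
     \<Delta>_pr \<alpha> a l u * norm (dual_residual a j k u p) + (\<Delta>_pr \<alpha> a l u)\<^sup>2 * \<gamma>"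

end

theory Submission
  imports Defs
begin

text \<open>
  Inf-sup stability turns a bound on \<open>a u\<close> as a functional on the test space into a bound on
  \<open>norm u\<close> (lemma \<open>infsup_norm_le\<close>). Each error is such a \<open>u\<close>, because the functional that it
  induces is a residual: on the discrete test space, \<open>a (u\<^sub>h - u\<^sub>r)\<close> is the primal residual, and
  in the second argument \<open>p\<^sub>h - p\<^sub>r\<close> gives the dual residual plus the term
  \<open>2 * k q (u\<^sub>h - u\<^sub>r)\<close>, which arises because the two adjoint equations are linearised at
  different primal states.

  The constant, however, controls the first argument of \<open>a\<close>, whereas the dual error sits in the
  second. Equality of the two dimensions closes this gap: by stability \<open>a\<close> is injective from
  the trial space into the functionals on the test space, hence bijective. So every
  functional \<open>inner p\<close> on the test space has a preimage \<open>u\<close> (lemma \<open>infsup_representer\<close>), and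
  testing \<open>p\<close> with this \<open>u\<close> gives the same constant for the transposed problem (lemma
  \<open>infsup_norm_le_transposed\<close>).

  For the output, expand the quadratic cost about \<open>u\<^sub>r\<close>. With \<open>e = u\<^sub>h - u\<^sub>r\<close>, the linear part of
  the difference is the dual residual at \<open>e\<close> plus \<open>a e p\<^sub>r\<close>, and \<open>a e p\<^sub>r\<close> vanishes by Galerkin
  orthogonality, as \<open>p\<^sub>r\<close> is a test function for both primal equations. What remains is the
  quadratic remainder \<open>k e e\<close>.
\<close>

lemma continuity_const_nonneg:
  assumes "bounded_bilinear k"
  shows "0 \<le> continuity_const k"
proof (cases "\<exists>x::'a. x \<noteq> 0")
  case True
  then obtain x :: 'a where "x \<noteq> 0" by blast
  have "0 \<le> continuity_const k * norm x * norm x"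
    using continuity_const_bound[OF assms, of x x] by linarith
  with \<open>x \<noteq> 0\<close> show ?thesis by (simp add: zero_le_mult_iff)
next
  case False
  then have "(\<lambda>(u, v). \<bar>k u v\<bar> / (norm u * norm v)) = (\<lambda>_. 0)"
    by (auto simp: fun_eq_iff)
  then show ?thesis by (simp add: continuity_const_def)
qed

lemma linear_inj_on_image_eq_of_dim_eq:
  assumes T: "linear T" "inj_on T U"
    and U: "finite_dim_subspace U" and W: "finite_dim_subspace W"
    and dim: "dim U = dim W" and TU: "T ` U \<subseteq> W"
  shows "T ` U = W"
proof (rule ccontr)
  assume "T ` U \<noteq> W"
  with TU obtain w where w: "w \<in> W" "w \<notin> T ` U" by blast
  have sU: "subspace U"
    using U by (simp add: finite_dim_subspace_def)
  obtain B where B: "B \<subseteq> U" "independent B" "U \<subseteq> span B" "card B = dim U"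
    by (rule basis_exists)
  obtain C where C: "C \<subseteq> W" "independent C" "W \<subseteq> span C" "card C = dim W"
    by (rule basis_exists)
  have finB: "finite B" and finC: "finite C"
    using B(1,2) C(1,2) U W by (metis finite_dim_subspace_def independent_span_bound)+
  have spanB: "span B = U"
    using B(1,3) sU by (simp add: span_minimal subset_antisym)
  have indep: "independent (T ` B)"
    using T B(2) by (simp add: linear_independent_injective_image spanB)
  have "span (T ` B) = T ` U"
    using T(1) by (simp add: linear_span_image spanB)
  with w(2) indep have "independent (insert w (T ` B))"
    by (simp add: independent_insertI)
  moreover have "insert w (T ` B) \<subseteq> span C"
    using w(1) TU B(1) C(3) by blast
  ultimately have "card (insert w (T ` B)) \<le> card C"
    using finC independent_span_bound by blast
  moreover have "card (T ` B) = card B"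
    using T(2) B(1) by (meson card_image inj_on_subset)
  moreover have "w \<notin> T ` B"
    using w(2) B(1) by blast
  ultimately show False
    using finB dim B(4) C(4) by simp
qed

lemma infsup_inverse_nonneg:
  assumes "infsup_const a U W > 0"
  shows "0 \<le> real_of_ereal (inverse (infsup_const a U W))"
  using assms by (intro real_of_ereal_pos inverse_ereal_ge0I) simp

text \<open>The extended value \<open>\<infinity>\<close> fits in because a nonzero \<open>u\<close> already forces the constant to be at
  most the finite number \<open>C / norm u\<close>; so it can occur only for \<open>u = 0\<close>.\<close>

lemma infsup_norm_le:
  assumes pos: "infsup_const a U W > 0" and u: "u \<in> U" and C: "0 \<le> C"
    and le: "\<And>v. v \<in> W \<Longrightarrow> a u v \<le> C * norm v"
  shows "norm u \<le> real_of_ereal (inverse (infsup_const a U W)) * C"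
proof (cases "u = 0")
  case True
  with C infsup_inverse_nonneg[OF pos] show ?thesis by simp
next
  case False
  have "infsup_const a U W \<le> (SUP v \<in> W - {0}. ereal (a u v / (norm u * norm v)))"
    unfolding infsup_const_def using u False by (intro INF_lower) simp
  also have "\<dots> \<le> ereal (C / norm u)"
    using le False by (intro SUP_least) (auto simp: field_simps)
  finally have ub: "infsup_const a U W \<le> ereal (C / norm u)" .
  with pos obtain r where r: "infsup_const a U W = ereal r" "0 < r"
    by (cases "infsup_const a U W") auto
  with ub have "r \<le> C / norm u" by simp
  with r False show ?thesis by (simp add: field_simps)
qed

text \<open>The functionals on \<open>W\<close> are encoded by their values on a basis \<open>C\<close> of \<open>W\<close>, and these
  values in turn as coefficients of a vector of \<open>W\<close>. The form thereby becomes a linear map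
  between two spaces of equal dimension, for which injectivity implies surjectivity.\<close>

lemma infsup_representer:
  fixes a :: "'v::real_inner \<Rightarrow> 'v \<Rightarrow> real"
  assumes a: "bounded_bilinear a"
    and U: "finite_dim_subspace U" and W: "finite_dim_subspace W"
    and dim: "dim U = dim W" and pos: "infsup_const a U W > 0"
  obtains u where "u \<in> U" "\<And>v. v \<in> W \<Longrightarrow> a u v = inner p v"
proof -
  interpret a: bounded_bilinear a by fact
  have sU: "subspace U" and sW: "subspace W"
    using U W by (auto simp: finite_dim_subspace_def)
  obtain C where C: "C \<subseteq> W" "independent C" "W \<subseteq> span C" "card C = dim W"
    by (rule basis_exists)
  have finC: "finite C"
    using C(1,2) W by (metis finite_dim_subspace_def independent_span_bound)
  have coeffs: "f c = g c"
    if eq: "(\<Sum>c\<in>C. f c *\<^sub>R c) = (\<Sum>c\<in>C. g c *\<^sub>R c)" and "c \<in> C" for f g c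
  proof -
    have "(\<Sum>c\<in>C. (f c - g c) *\<^sub>R c) = 0"
      using eq by (simp add: scaleR_left_diff_distrib sum_subtractf)
    from independentD[OF C(2) finC subset_refl this \<open>c \<in> C\<close>] show ?thesis by simp
  qed
  have extend: "a u v = inner q v" if "\<And>c. c \<in> C \<Longrightarrow> a u c = inner q c" "v \<in> W" for u q v
  proof (rule linear_eq_on[where B = C])
    show "linear (a u)" "linear (inner q)"
      by (simp_all add: a.bounded_linear_right bounded_linear.linear bounded_linear_inner_right)
  qed (use that C(3) in blast)+
  define T where "T u = (\<Sum>c\<in>C. a u c *\<^sub>R c)" for u
  have T: "linear T"
    by (rule linearI)
      (simp_all add: T_def a.add_left a.scaleR_left scaleR_left_distrib sum.distrib scaleR_sum_right)
  have "inj_on T U"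
  proof (rule linear_injective_on_subspace_0[OF T sU, THEN iffD2], intro ballI impI)
    fix u assume u: "u \<in> U" "T u = 0"
    have "a u v = inner 0 v" if "v \<in> W" for v
      using that by (rule extend[rotated]) (use coeffs[of "a u" "\<lambda>_. 0"] u(2) in \<open>auto simp: T_def\<close>)
    with infsup_norm_le[OF pos u(1), of 0] show "u = 0" by simp
  qed
  moreover have inW: "(\<Sum>c\<in>C. f c *\<^sub>R c) \<in> W" for f
    using C(1) sW by (intro subspace_sum) (auto intro: subspace_scale)
  ultimately have "T ` U = W"
    by (intro linear_inj_on_image_eq_of_dim_eq T U W dim) (auto simp: T_def)
  with inW[of "inner p"] obtain u where u: "u \<in> U" "T u = (\<Sum>c\<in>C. inner p c *\<^sub>R c)"
    by (metis imageE)
  have "a u c = inner p c" if "c \<in> C" for c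
    using coeffs[of "a u" "inner p"] u(2) that by (simp add: T_def)
  with extend u(1) that show thesis by blast
qed

text \<open>If \<open>u\<close> represents \<open>p\<close> on \<open>W\<close>, then stability gives \<open>\<alpha> * norm u \<le> norm p\<close>, while
  \<open>a u p\<close> equals the square of \<open>norm p\<close>: so \<open>u\<close> is a test vector on which the functional
  \<open>\<lambda>q. a q p\<close> is as large as the original constant demands.\<close>

lemma infsup_norm_le_transposed:
  fixes a :: "'v::real_inner \<Rightarrow> 'v \<Rightarrow> real"
  assumes a: "bounded_bilinear a"
    and U: "finite_dim_subspace U" and W: "finite_dim_subspace W"
    and dim: "dim U = dim W" and pos: "infsup_const a U W > 0"
    and p: "p \<in> W" and C: "0 \<le> C"
    and le: "\<And>q. q \<in> U \<Longrightarrow> a q p \<le> C * norm q"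
  shows "norm p \<le> real_of_ereal (inverse (infsup_const a U W)) * C"
proof (cases "p = 0")
  case True
  with C infsup_inverse_nonneg[OF pos] show ?thesis by simp
next
  case False
  obtain u where u: "u \<in> U" "\<And>v. v \<in> W \<Longrightarrow> a u v = inner p v"
    using infsup_representer[OF a U W dim pos] by blast
  have nu: "norm u \<le> real_of_ereal (inverse (infsup_const a U W)) * norm p"
    using u by (intro infsup_norm_le[where W = W] pos) (auto simp: norm_cauchy_schwarz)
  have "norm p * norm p = a u p"
    using u(2)[OF p] by (simp add: dot_square_norm power2_eq_square)
  also have "\<dots> \<le> C * norm u" by (rule le[OF u(1)])
  also have "\<dots> \<le> C * (real_of_ereal (inverse (infsup_const a U W)) * norm p)"
    by (rule mult_left_mono[OF nu C])
  finally have "norm p * norm p \<le> (real_of_ereal (inverse (infsup_const a U W)) * C) * norm p"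
    by (simp add: mult_ac)
  with False show ?thesis by (intro mult_right_le_imp_le[of "norm p" "norm p"]) simp_all
qed

theorem proposition2p1:
  fixes \<mu>\<^sub>a \<mu>\<^sub>b \<mu> :: "real ^ 'p"
    and a k :: "real ^ 'p \<Rightarrow> 'v::{real_inner, complete_space} \<Rightarrow> 'v \<Rightarrow> real"
    and l j :: "real ^ 'p \<Rightarrow> 'v \<Rightarrow> real"
    and \<Theta> :: "real ^ 'p \<Rightarrow> real"
    and Vh_pr Vh_du Vr_pr Vr_du :: "'v set"
    and u\<^sub>h p\<^sub>h u\<^sub>r p\<^sub>r :: "real ^ 'p \<Rightarrow> 'v"
  assumes a_bilinear: "\<And>\<nu>. \<nu> \<in> {\<mu>\<^sub>a..\<mu>\<^sub>b} \<Longrightarrow> bounded_bilinear (a \<nu>)"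
    and a_coercive: "\<And>\<nu>. \<nu> \<in> {\<mu>\<^sub>a..\<mu>\<^sub>b} \<Longrightarrow> coercive (a \<nu>)"
    and l_linear: "\<And>\<nu>. \<nu> \<in> {\<mu>\<^sub>a..\<mu>\<^sub>b} \<Longrightarrow> bounded_linear (l \<nu>)"
    and j_linear: "\<And>\<nu>. \<nu> \<in> {\<mu>\<^sub>a..\<mu>\<^sub>b} \<Longrightarrow> bounded_linear (j \<nu>)"
    and k_bilinear: "\<And>\<nu>. \<nu> \<in> {\<mu>\<^sub>a..\<mu>\<^sub>b} \<Longrightarrow> bounded_bilinear (k \<nu>)"
    and k_symmetric: "\<And>\<nu> u v. \<nu> \<in> {\<mu>\<^sub>a..\<mu>\<^sub>b} \<Longrightarrow> k \<nu> u v = k \<nu> v u"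
    and Vh_pr: "finite_dim_subspace Vh_pr"
    and Vh_du: "finite_dim_subspace Vh_du"
    and dim_h: "dim Vh_pr = dim Vh_du"
    and Vr_pr: "subspace Vr_pr" "Vr_pr \<subseteq> Vh_pr"
    and Vr_du: "subspace Vr_du" "Vr_du \<subseteq> Vh_du"
    and dim_r: "dim Vr_pr = dim Vr_du"
    and infsup: "\<And>\<nu>. \<nu> \<in> {\<mu>\<^sub>a..\<mu>\<^sub>b} \<Longrightarrow> infsup_const (a \<nu>) Vh_pr Vh_du > 0"
    and \<mu>: "\<mu> \<in> {\<mu>\<^sub>a..\<mu>\<^sub>b}"
    and u\<^sub>h: "u\<^sub>h \<mu> \<in> Vh_pr" "\<And>v. v \<in> Vh_du \<Longrightarrow> a \<mu> (u\<^sub>h \<mu>) v = l \<mu> v"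
    and p\<^sub>h: "p\<^sub>h \<mu> \<in> Vh_du"
      "\<And>q. q \<in> Vh_pr \<Longrightarrow> a \<mu> q (p\<^sub>h \<mu>) = j \<mu> q + 2 * k \<mu> q (u\<^sub>h \<mu>)"
    and u\<^sub>r: "u\<^sub>r \<mu> \<in> Vr_pr" "\<And>v. v \<in> Vr_du \<Longrightarrow> a \<mu> (u\<^sub>r \<mu>) v = l \<mu> v"
    and p\<^sub>r: "p\<^sub>r \<mu> \<in> Vr_du"
      "\<And>q. q \<in> Vr_pr \<Longrightarrow> a \<mu> q (p\<^sub>r \<mu>) = j \<mu> q + 2 * k \<mu> q (u\<^sub>r \<mu>)"
  shows "norm (u\<^sub>h \<mu> - u\<^sub>r \<mu>)
      \<le> \<Delta>_pr (infsup_const (a \<mu>) Vh_pr Vh_du) (a \<mu>) (l \<mu>) (u\<^sub>r \<mu>)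
    \<and> norm (p\<^sub>h \<mu> - p\<^sub>r \<mu>)
      \<le> \<Delta>_du (infsup_const (a \<mu>) Vh_pr Vh_du) (continuity_const (k \<mu>))
          (a \<mu>) (l \<mu>) (j \<mu>) (k \<mu>) (u\<^sub>r \<mu>) (p\<^sub>r \<mu>)
    \<and> \<bar>reduced_cost \<Theta> j k u\<^sub>h \<mu> - reduced_cost \<Theta> j k u\<^sub>r \<mu>\<bar>
      \<le> \<Delta>_J (infsup_const (a \<mu>) Vh_pr Vh_du) (continuity_const (k \<mu>))
          (a \<mu>) (l \<mu>) (j \<mu>) (k \<mu>) (u\<^sub>r \<mu>) (p\<^sub>r \<mu>)"
proof -
  let ?a = "a \<mu>" and ?l = "l \<mu>" and ?j = "j \<mu>" and ?k = "k \<mu>"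
  let ?uh = "u\<^sub>h \<mu>" and ?ph = "p\<^sub>h \<mu>" and ?ur = "u\<^sub>r \<mu>" and ?pr = "p\<^sub>r \<mu>"
  let ?\<alpha> = "infsup_const ?a Vh_pr Vh_du" and ?\<gamma> = "continuity_const ?k"
  let ?D = "\<Delta>_pr ?\<alpha> ?a ?l ?ur"
  let ?rpr = "primal_residual ?a ?l ?ur" and ?rdu = "dual_residual ?a ?j ?k ?ur ?pr"
  note a = a_bilinear[OF \<mu>] and k = k_bilinear[OF \<mu>] and sym = k_symmetric[OF \<mu>]
    and pos = infsup[OF \<mu>]
  interpret a: bounded_bilinear ?a by (fact a)
  interpret k: bounded_bilinear ?k by (fact k)
  interpret j: bounded_linear ?j by (rule j_linear[OF \<mu>])
  note rpr = primal_residual_apply[OF a l_linear[OF \<mu>]]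
    and rdu = dual_residual_apply[OF a j_linear[OF \<mu>] k]
  define e where "e = ?uh - ?ur"
  have \<gamma>: "0 \<le> ?\<gamma>" by (rule continuity_const_nonneg[OF k])
  have functional_le: "blinfun_apply r v \<le> norm r * norm v" for r :: "'v \<Rightarrow>\<^sub>L real" and v
    using norm_blinfun[of r v] by simp

  have "e \<in> Vh_pr"
    using u\<^sub>h(1) u\<^sub>r(1) Vr_pr(2) Vh_pr
    by (auto simp: e_def finite_dim_subspace_def intro: subspace_diff)
  have primal: "norm e \<le> ?D"
    unfolding \<Delta>_pr_def
  proof (rule infsup_norm_le[OF pos \<open>e \<in> Vh_pr\<close>])
    fix v assume "v \<in> Vh_du"
    then have "?a e v = blinfun_apply ?rpr v"
      by (simp add: e_def rpr a.diff_left u\<^sub>h(2))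
    then show "?a e v \<le> norm ?rpr * norm v"
      by (simp add: functional_le)
  qed simp
  then have D: "0 \<le> ?D" using norm_ge_zero order_trans by blast

  have "norm (?ph - ?pr) \<le> \<Delta>_du ?\<alpha> ?\<gamma> ?a ?l ?j ?k ?ur ?pr"
    unfolding \<Delta>_du_def
  proof (rule infsup_norm_le_transposed[OF a Vh_pr Vh_du dim_h pos])
    show "?ph - ?pr \<in> Vh_du"
      using p\<^sub>h(1) p\<^sub>r(1) Vr_du(2) Vh_du
      by (auto simp: finite_dim_subspace_def intro: subspace_diff)
    show "0 \<le> 2 * ?\<gamma> * ?D + norm ?rdu" using \<gamma> D by simp
    fix q assume q: "q \<in> Vh_pr"
    have "?k q e \<le> ?\<gamma> * norm q * norm e"
      using continuity_const_bound[OF k, of q e] by linarith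
    also have "\<dots> \<le> ?\<gamma> * norm q * ?D"
      using primal \<gamma> by (intro mult_left_mono) auto
    finally have kq: "?k q e \<le> ?\<gamma> * norm q * ?D" .
    have "?a q (?ph - ?pr) = 2 * ?k q e + blinfun_apply ?rdu q"
      using p\<^sub>h(2)[OF q] by (simp add: e_def rdu a.diff_right k.diff_right)
    also have "\<dots> \<le> 2 * (?\<gamma> * norm q * ?D) + norm ?rdu * norm q"
      using kq functional_le[of ?rdu q] by linarith
    also have "\<dots> = (2 * ?\<gamma> * ?D + norm ?rdu) * norm q"
      by (simp add: algebra_simps)
    finally show "?a q (?ph - ?pr) \<le> (2 * ?\<gamma> * ?D + norm ?rdu) * norm q" .
  qed
  moreover have "\<bar>reduced_cost \<Theta> j k u\<^sub>h \<mu> - reduced_cost \<Theta> j k u\<^sub>r \<mu>\<bar>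
      \<le> \<Delta>_J ?\<alpha> ?\<gamma> ?a ?l ?j ?k ?ur ?pr"
  proof -
    have orth: "?a e ?pr = 0"
      using p\<^sub>r(1) Vr_du(2) u\<^sub>h(2) u\<^sub>r(2) by (auto simp: e_def a.diff_left)
    have "reduced_cost \<Theta> j k u\<^sub>h \<mu> - reduced_cost \<Theta> j k u\<^sub>r \<mu>
        = ?j e + 2 * ?k e ?ur + ?k e e"
      using sym[of ?ur ?uh]
      by (simp add: reduced_cost_def cost_def e_def j.diff k.diff_left k.diff_right)
    also have "\<dots> = blinfun_apply ?rdu e + ?k e e"
      by (simp add: rdu orth)
    finally have "\<bar>reduced_cost \<Theta> j k u\<^sub>h \<mu> - reduced_cost \<Theta> j k u\<^sub>r \<mu>\<bar>
        \<le> \<bar>blinfun_apply ?rdu e\<bar> + \<bar>?k e e\<bar>"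
      by simp
    also have "\<bar>blinfun_apply ?rdu e\<bar> \<le> norm ?rdu * norm e"
      using norm_blinfun[of ?rdu e] by simp
    also have "\<dots> \<le> ?D * norm ?rdu"
      using mult_left_mono[OF primal, of "norm ?rdu"] by (simp add: mult.commute)
    also have "\<bar>?k e e\<bar> \<le> ?\<gamma> * (norm e)\<^sup>2"
      using continuity_const_bound[OF k, of e e] by (simp add: power2_eq_square mult.assoc)
    also have "\<dots> \<le> ?D\<^sup>2 * ?\<gamma>"
      using mult_left_mono[OF power_mono[OF primal norm_ge_zero] \<gamma>, of 2]
      by (simp add: mult.commute)
    finally show ?thesis by (simp add: \<Delta>_J_def)
  qed
  ultimately show ?thesis
    using primal by (simp add: e_def)
qed

end
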